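(* Let $W$ be an irreducible $T$-module with endpoint $r$ and diameter $d=D-2r$. Let $u\in E_rW$, $u^*\in E_r^*W$, $u^{\varepsilon}\in E_r^{\varepsilon}W$ be nonzero vectors. Consider the $(d+1)\times(d+1)$ tridiagonal matrix $$B=\begin{pmatrix}0&d&&&&0\\1&0&d-1&&&\\&2&\cdot&\cdot&&\\&&\cdot&\cdot&\cdot&\\&&&\cdot&\cdot&1\\0&&&&d&0\end{pmatrix},$$ i.e. $B_{i,i-1}=i$ for $1\le i\le d$, $B_{i,i+1}=d-i$ for $0\le i\le d-1$, and all other entries are $0$. Then the following hold. (i) $B$ represents $A$ with respect to the bases $E^*_ru,\ldots,E^*_{r+d}u$ and $E^{\varepsilon}_ru,\ldots,E^{\varepsilon}_{r+d}u$ of $W$. (ii) $B$ represents $A^*$ with respect to the bases $E^{\varepsilon}_ru^*,\ldots,E^{\varepsilon}_{r+d}u^*$ and $E_ru^*,\ldots,E_{r+d}u^*$ of $W$. (iii) $B$ represents $A^{\varepsilon}$ with respect to the bases $E_ru^{\varepsilon},\ldots,E_{r+d}u^{\varepsilon}$ and $E^*_ru^{\varepsilon},\ldots,E^*_{r+d}u^{\varepsilon}$ of $W$.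
   Context: Let $D$ be a positive integer and let $Q_D$ be the $D$-cube: the graph with vertex set $X=\{0,1\}^D$, two vertices being adjacent iff they differ in exactly one coordinate; $\partial$ denotes path-length distance. $\mathrm{Mat}_X(\mathbb{C})$ is the algebra of complex matrices with rows and columns indexed by $X$, acting on $V=\mathbb{C}^X$ (column vectors) by left multiplication. Write $\mathbf{i}^2=-1$. Let $A$ be the adjacency matrix of $Q_D$. Fix $x=(0,0,\ldots,0)\in X$. Let $A^*$ be the diagonal matrix in $\mathrm{Mat}_X(\mathbb{C})$ with $(y,y)$-entry $D-2\partial(x,y)$ for $y\in X$, and let $A^{\varepsilon}=-\mathbf{i}(AA^*-A^*A)/2$. Let $T$ be the subalgebra of $\mathrm{Mat}_X(\mathbb{C})$ generated by $A$ and $A^*$. The eigenvalues of $A$ are $\theta_i=D-2i$ $(0\le i\le D)$. For $0\le i\le D$: $E_i=\prod_{0\le j\le D,\,j\ne i}\frac{A-\theta_jI}{\theta_i-\theta_j}$ is the primitive idempotent of $A$ for $\theta_i$ (the orthogonal projection onto the $\theta_i$-eigenspace of $A$); $E_i^*$ is the diagonal matrix with $(y,y)$-entry $1$ if $\partial(x,y)=i$ and $0$ otherwise; and $E_i^{\varepsilon}=P^{-1}E_iP$, where $P=P_1^{\otimes D}$ (Kronecker power, $P_{yz}=\prod_{k=1}^D(P_1)_{y_kz_k}$, invertible) with $P_1=\begin{pmatrix}1&1\\-\mathbf{i}&\mathbf{i}\end{pmatrix}$, rows and columns indexed by $0,1$ in that order. ($E_i^*$ and $E_i^{\varepsilon}$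 are the primitive idempotents of $A^*$ and $A^{\varepsilon}$ for the eigenvalue $D-2i$.) A $T$-module is a subspace $W\subseteq V$ with $BW\subseteq W$ for all $B\in T$; it is irreducible if $W\ne0$ and it contains no $T$-modules other than $0$ and $W$. The endpoint of an irreducible $T$-module $W$ is $r=\min\{i\mid 0\le i\le D,\ E_i^*W\neq0\}$ (it is known that also $r=\min\{i\mid E_iW\ne0\}$), and its diameter is $d=|\{i\mid 0\le i\le D,\ E_i^*W\ne0\}|-1$; it is known that $d=D-2r$ and $0\le r\le D/2$. For nonzero $u\in E_rW$, $u^*\in E^*_rW$, $u^{\varepsilon}\in E^{\varepsilon}_rW$, each of the six sequences $(E^*_{r+i}u)_{i=0}^d$, $(E^{\varepsilon}_{r+i}u)_{i=0}^d$, $(E^{\varepsilon}_{r+i}u^* )_{i=0}^d$, $(E_{r+i}u^* )_{i=0}^d$, $(E_{r+i}u^{\varepsilon})_{i=0}^d$, $(E^*_{r+i}u^{\varepsilon})_{i=0}^d$ is a basis of $W$. Convention: a $(d+1)\times(d+1)$ matrix $B$ (rows and columns indexed $0,\ldots,d$) represents $Y\in T$ with respect to a basis $v_0,\ldots,v_d$ of $W$ if $Yv_j=\sum_{i=0}^dB_{ij}v_i$ for $0\le j\le d$. *)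

theory Defs
  imports "HOL-Analysis.Analysis"
begin

text \<open>The \<open>D\<close>-cube is rendered with \<open>D = CARD('n)\<close> for a finite index type \<open>'n\<close>: its vertex set
  \<open>X = {0,1}\<^sup>D\<close> is the type \<open>bool ^ 'n\<close>, where \<open>False\<close> stands for 0 and \<open>True\<close> for 1. Since types
  are nonempty, \<open>D\<close> is positive.\<close>

type_synonym 'n vertex = "bool ^ 'n"
type_synonym 'n cvec = "complex ^ 'n vertex"
type_synonym 'n cmat = "complex ^ 'n vertex ^ 'n vertex"

definition cube_adj :: "'n::finite vertex \<Rightarrow> 'n vertex \<Rightarrow> bool" where
  "cube_adj y z \<longleftrightarrow> card {k. y $ k \<noteq> z $ k} = 1"

definition cube_dist :: "'n::finite vertex \<Rightarrow> 'n vertex \<Rightarrow> nat" where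
  "cube_dist y z = (LEAST n. (cube_adj ^^ n) y z)"

definition base_vertex :: "'n::finite vertex" where
  "base_vertex = (\<chi> k. False)"

text \<open>On the type of matrices, \<open>*\<close> and \<open>^\<close> are entrywise, and only real scalars are available
  through \<open>*\<^sub>R\<close>; hence a complex scalar multiple of its own.\<close>

definition cscale :: "complex \<Rightarrow> 'n::finite cmat \<Rightarrow> 'n cmat" (infixr "*\<^sub>M" 75) where
  "c *\<^sub>M B = (\<chi> y z. c * B $ y $ z)"

definition A_mat :: "'n::finite cmat" where
  "A_mat = (\<chi> y z. if cube_adj y z then 1 else 0)"

definition theta :: "nat \<Rightarrow> nat \<Rightarrow> complex" where
  "theta D i = of_nat D - 2 * of_nat i"

definition Astar_mat :: "'n::finite cmat" where
  "Astar_mat = (\<chi> y z. if y = z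
      then of_nat CARD('n) - 2 * of_nat (cube_dist base_vertex y) else 0)"

definition Aeps_mat :: "'n::finite cmat" where
  "Aeps_mat = (- \<i> / 2) *\<^sub>M (A_mat ** Astar_mat - Astar_mat ** A_mat)"

text \<open>The factors of the product commute, so the order fixed by the list is immaterial.\<close>

definition E_mat :: "nat \<Rightarrow> 'n::finite cmat" where
  "E_mat i = foldr (**)
     (map (\<lambda>j. (1 / (theta CARD('n) i - theta CARD('n) j)) *\<^sub>M
                (A_mat - theta CARD('n) j *\<^sub>M mat 1))
          (filter (\<lambda>j. j \<noteq> i) [0..<Suc CARD('n)]))
     (mat 1)"

definition Estar_mat :: "nat \<Rightarrow> 'n::finite cmat" where
  "Estar_mat i = (\<chi> y z. if y = z \<and> cube_dist base_vertex y = i then 1 else 0)"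

definition P1_entry :: "bool \<Rightarrow> bool \<Rightarrow> complex" where
  "P1_entry a b = (if \<not> a then 1 else if b then \<i> else - \<i>)"

definition P_mat :: "'n::finite cmat" where
  "P_mat = (\<chi> y z. \<Prod>k\<in>UNIV. P1_entry (y $ k) (z $ k))"

definition Eeps_mat :: "nat \<Rightarrow> 'n::finite cmat" where
  "Eeps_mat i = matrix_inv P_mat ** E_mat i ** P_mat"

definition is_subalgebra :: "'n::finite cmat set \<Rightarrow> bool" where
  "is_subalgebra S \<longleftrightarrow> 0 \<in> S \<and> mat 1 \<in> S \<and>
     (\<forall>B\<in>S. \<forall>C\<in>S. B + C \<in> S \<and> B ** C \<in> S) \<and> (\<forall>c. \<forall>B\<in>S. c *\<^sub>M B \<in> S)"

definition T_alg :: "'n::finite cmat set" where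
  "T_alg = is_subalgebra hull {A_mat, Astar_mat}"

definition T_module :: "'n::finite cvec set \<Rightarrow> bool" where
  "T_module W \<longleftrightarrow> vec.subspace W \<and> (\<forall>B\<in>T_alg. \<forall>w\<in>W. B *v w \<in> W)"

definition irreducible_T_module :: "'n::finite cvec set \<Rightarrow> bool" where
  "irreducible_T_module W \<longleftrightarrow> T_module W \<and> W \<noteq> {0} \<and>
     (\<forall>U. T_module U \<and> U \<subseteq> W \<longrightarrow> U = {0} \<or> U = W)"

definition mat_image :: "'n::finite cmat \<Rightarrow> 'n cvec set \<Rightarrow> 'n cvec set" where
  "mat_image B W = (\<lambda>w. B *v w) ` W"

definition module_support :: "'n::finite cvec set \<Rightarrow> nat set" where
  "module_support W = {i. i \<le> CARD('n) \<and> mat_image (Estar_mat i) W \<noteq> {0}}"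

definition module_endpoint :: "'n::finite cvec set \<Rightarrow> nat" where
  "module_endpoint W = Min (module_support W)"

definition module_diameter :: "'n::finite cvec set \<Rightarrow> nat" where
  "module_diameter W = card (module_support W) - 1"

definition basis_of :: "'n::finite cvec set \<Rightarrow> nat \<Rightarrow> (nat \<Rightarrow> 'n cvec) \<Rightarrow> bool" where
  "basis_of W d v \<longleftrightarrow> inj_on v {0..d} \<and> vec.independent (v ` {0..d}) \<and> vec.span (v ` {0..d}) = W"

text \<open>A matrix with rows and columns indexed \<open>0, \<dots>, d\<close> is a function on pairs of naturals, of which
  only the entries with both indices at most \<open>d\<close> matter.\<close>

definition represents ::
  "'n::finite cvec set \<Rightarrow> nat \<Rightarrow> (nat \<Rightarrow> nat \<Rightarrow> complex) \<Rightarrow> 'n cmat \<Rightarrow> (nat \<Rightarrow> 'n cvec) \<Rightarrow> bool" where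
  "represents W d B Y v \<longleftrightarrow> basis_of W d v \<and>
     (\<forall>j\<le>d. Y *v v j = (\<Sum>i=0..d. B i j *s v i))"

definition B_tridiag :: "nat \<Rightarrow> nat \<Rightarrow> nat \<Rightarrow> complex" where
  "B_tridiag d i j =
     (if i = j + 1 then of_nat i else if j = i + 1 then of_nat (d - i) else 0)"

end

theory Submission
  imports Defs
begin

text \<open>The matrices \<open>A\<close>, \<open>A*\<close>, \<open>A\<^sup>\<epsilon>\<close> satisfy \<open>[X, Y] = 2iZ\<close> and its cyclic rotations, and conjugation by
  \<open>P\<close> carries \<open>A*\<close> to \<open>A\<close> and \<open>A\<close> to \<open>A\<^sup>\<epsilon>\<close>. Highest weight theory shows that on an irreducible module
  of dimension \<open>d + 1\<close> the weights of each of the three are \<open>d, d - 2, \<dots>, -d\<close>, so that the three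
  endpoints agree. If \<open>u\<close> is a highest weight vector for \<open>X\<close>, then \<open>(Y + iZ)u = 0\<close>; hence
  \<open>(Z \<plusminus> iX)u = i(Y \<plusminus> d)u\<close>. As \<open>Z \<plusminus> iX\<close> shifts the eigenspaces of \<open>Y\<close>, comparing the
  \<open>Y\<close>-components of both sides gives the action of \<open>X\<close> on the components of \<open>u\<close>. They span a
  submodule containing \<open>u\<close>, that is, all of \<open>W\<close>. Replacing \<open>i\<close> by \<open>-i\<close> exchanges
  the roles of \<open>Y\<close> and \<open>Z\<close>.\<close>

subsection \<open>Eigencomponents and spectral families\<close>

definition invariant :: "'a::field ^ 'm ^ 'm \<Rightarrow> ('a ^ 'm) set \<Rightarrow> bool" where
  "invariant M U \<longleftrightarrow> (\<forall>v\<in>U. M *v v \<in> U)"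

text \<open>Relative to a set of matrices rather than to an algebra, so that reordering the three
  generators is mere equality of sets.\<close>

definition irreducible_under :: "('a::field ^ 'm ^ 'm) set \<Rightarrow> ('a ^ 'm) set \<Rightarrow> bool" where
  "irreducible_under S W \<longleftrightarrow> vec.subspace W \<and> W \<noteq> {0} \<and> (\<forall>M\<in>S. invariant M W) \<and>
     (\<forall>U. vec.subspace U \<and> U \<subseteq> W \<and> (\<forall>M\<in>S. invariant M U) \<longrightarrow> U = {0} \<or> U = W)"

text \<open>A resolution of the identity into eigenvectors. Idempotence and mutual annihilation of
  the \<open>E i\<close> follow, as the \<open>theta D i\<close> are distinct.\<close>

definition spectral_family :: "nat \<Rightarrow> complex ^ 'm ^ 'm \<Rightarrow> (nat \<Rightarrow> complex ^ 'm ^ 'm) \<Rightarrow> bool" where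
  "spectral_family D X E \<longleftrightarrow> (\<forall>v. (\<Sum>i\<le>D. E i *v v) = v) \<and>
     (\<forall>i\<le>D. \<forall>v. X *v (E i *v v) = theta D i *s (E i *v v))"

definition weight_support :: "nat \<Rightarrow> complex ^ 'm ^ 'm \<Rightarrow> (complex ^ 'm) set \<Rightarrow> nat set" where
  "weight_support D X W = {i. i \<le> D \<and> (\<exists>w\<in>W. w \<noteq> 0 \<and> X *v w = theta D i *s w)}"

lemma mv_sum: "M *v (\<Sum>i\<in>S. f i) = (\<Sum>i\<in>S. M *v f i)"
  for M :: "'a::field ^ 'm ^ 'k"
  by (induction S rule: infinite_finite_induct) (simp_all add: matrix_vector_right_distrib)

lemma theta_eq_iff [simp]: "theta D i = theta D j \<longleftrightarrow> i = j"
  by (simp add: theta_def)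

lemma theta_add: "theta D (i + k) = theta D i - 2 * of_nat k"
  by (simp add: theta_def)

lemma theta_Suc: "theta D (Suc i) = theta D i - 2"
  by (simp add: theta_def)

lemma theta_plus_2_iff [simp]: "theta D i + 2 = theta D j \<longleftrightarrow> i = Suc j"
proof -
  have "theta D i + 2 = theta D j \<longleftrightarrow> theta D i = theta D (Suc j)"
    unfolding theta_Suc by (rule eq_diff_eq [symmetric])
  then show ?thesis by simp
qed

lemma theta_minus_2_iff [simp]: "theta D i - 2 = theta D j \<longleftrightarrow> j = Suc i"
  by (simp flip: theta_Suc) auto

text \<open>Induction on \<open>S\<close>: \<open>M - t a\<close> kills the component
  \<open>x a\<close> and multiplies every other \<open>x i\<close> by the nonzero number
  \<open>t i - t a\<close>, leaving a shorter sum in \<open>W\<close>.\<close>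

lemma eigencomponents_in_invariant_subspace:
  fixes M :: "'a::field ^ 'm ^ 'm"
  assumes "finite S" "vec.subspace W" "invariant M W" "inj_on t S"
    and "\<And>i. i \<in> S \<Longrightarrow> M *v x i = t i *s x i" and "(\<Sum>i\<in>S. x i) \<in> W" and "i \<in> S"
  shows "x i \<in> W"
  using assms(1,4-)
proof (induction S arbitrary: x i rule: finite_induct)
  case empty
  then show ?case by simp
next
  case (insert a S)
  let ?s = "\<Sum>i\<in>insert a S. x i"
  have "M *v ?s - t a *s ?s = (\<Sum>i\<in>insert a S. (t i - t a) *s x i)"
    using insert.prems(2)
    by (simp only: mv_sum vec.scale_sum_right sum_subtractf [symmetric] vec.scale_left_diff_distrib
        cong: sum.cong)
  also have "\<dots> = (\<Sum>i\<in>S. (t i - t a) *s x i)"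
    using insert.hyps by simp
  finally have "(\<Sum>i\<in>S. (t i - t a) *s x i) = M *v ?s - t a *s ?s" by simp
  also have "\<dots> \<in> W"
    using assms(2,3) insert.prems(3) unfolding invariant_def
    by (intro vec.subspace_diff vec.subspace_scale) auto
  finally have sum_in: "(\<Sum>i\<in>S. (t i - t a) *s x i) \<in> W" .
  have inS: "x j \<in> W" if "j \<in> S" for j
  proof -
    have "(t j - t a) *s x j \<in> W"
      using insert.prems(1,2) sum_in that
      by (intro insert.IH [where x = "\<lambda>i. (t i - t a) *s x i"])
        (auto simp: matrix_vector_mult_diff_distrib vector_scalar_commute mult.commute)
    then have "inverse (t j - t a) *s ((t j - t a) *s x j) \<in> W"
      using assms(2) vec.subspace_scale by blast
    moreover have "inverse (t j - t a) * (t j - t a) = 1"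
      using insert.prems(1) insert.hyps(2) that by (intro left_inverse) (auto simp: inj_on_def)
    ultimately show ?thesis by (simp only: vec.scale_scale vec.scale_one)
  qed
  have "x a = ?s - (\<Sum>i\<in>S. x i)" using insert.hyps by simp
  also have "\<dots> \<in> W"
    using insert.prems(3) inS assms(2) by (metis vec.subspace_diff vec.subspace_sum)
  finally show ?case using insert.prems(4) inS by auto
qed

lemma eigencomponents_zero:
  fixes M :: "'a::field ^ 'm ^ 'm"
  assumes "finite S" "inj_on t S" "\<And>i. i \<in> S \<Longrightarrow> M *v x i = t i *s x i" "(\<Sum>i\<in>S. x i) = 0" "i \<in> S"
  shows "x i = 0"
  using eigencomponents_in_invariant_subspace [of S "{0}" M t x i] assms
  by (simp add: invariant_def)

text \<open>A linear relation among the \<open>x i\<close> is a vanishing sum of eigenvectors with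
  distinct eigenvalues, so each of its terms is zero.\<close>

lemma eigenvectors_independent:
  fixes M :: "'a::field ^ 'm ^ 'm"
  assumes "finite S" "inj_on t S" "\<And>i. i \<in> S \<Longrightarrow> M *v x i = t i *s x i" "\<And>i. i \<in> S \<Longrightarrow> x i \<noteq> 0"
  shows "inj_on x S" "vec.independent (x ` S)"
proof -
  show inj: "inj_on x S"
    by (metis (mono_tags, lifting) assms(2-4) inj_on_def vec.scale_right_imp_eq)
  show "vec.independent (x ` S)"
  proof
    assume "vec.dependent (x ` S)"
    then obtain c where c: "\<exists>v\<in>x ` S. c v \<noteq> 0" "(\<Sum>v\<in>x ` S. c v *s v) = 0"
      using vec.dependent_finite [of "x ` S"] assms(1) by auto
    then obtain i where i: "i \<in> S" "c (x i) \<noteq> 0" by auto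
    have "c (x i) *s x i = 0"
      using c(2) assms(1-3) i
      by (intro eigencomponents_zero [of S t M "\<lambda>i. c (x i) *s x i"])
        (simp_all add: sum.reindex [OF inj] vector_scalar_commute mult.commute)
    then show False using i assms(4) by simp
  qed
qed

text \<open>Applying \<open>X - \<mu>\<close> to the decomposition of \<open>v\<close> gives a
  vanishing sum of eigenvectors, so \<open>E i *v v\<close> can be nonzero only where
  \<open>theta D i = \<mu>\<close>.\<close>

lemma spectral_family_apply_eigenvector:
  assumes E: "spectral_family D X E" and v: "X *v v = \<mu> *s v" and j: "j \<le> D"
  shows "E j *v v = (if \<mu> = theta D j then v else 0)"
proof -
  have sum: "(\<Sum>i\<le>D. E i *v v) = v" and eig: "\<And>i. i \<le> D \<Longrightarrow> X *v (E i *v v) = theta D i *s (E i *v v)"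
    using E by (auto simp: spectral_family_def)
  have "X *v (\<Sum>i\<le>D. E i *v v) = (\<Sum>i\<le>D. theta D i *s (E i *v v))"
    unfolding mv_sum by (intro sum.cong) (auto simp: eig)
  then have "(\<Sum>i\<le>D. (theta D i - \<mu>) *s (E i *v v)) = X *v (\<Sum>i\<le>D. E i *v v) - \<mu> *s (\<Sum>i\<le>D. E i *v v)"
    by (simp only: vec.scale_sum_right sum_subtractf vec.scale_left_diff_distrib)
  also have "\<dots> = 0" using v sum by simp
  finally have "(theta D i - \<mu>) *s (E i *v v) = 0" if "i \<le> D" for i
    using that eig
    by (intro eigencomponents_zero [of "{..D}" "theta D" X "\<lambda>i. (theta D i - \<mu>) *s (E i *v v)"])
      (auto simp: matrix_vector_mult_diff_distrib vector_scalar_commute mult.commute inj_on_def)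
  then have z: "E i *v v = 0" if "i \<le> D" "\<mu> \<noteq> theta D i" for i
    using that by fastforce
  show ?thesis
  proof (cases "\<mu> = theta D j")
    case True
    have "v = (\<Sum>i\<le>D. E i *v v)" by (simp add: sum)
    also have "\<dots> = (\<Sum>i\<in>{j}. E i *v v)"
      using j True z by (intro sum.mono_neutral_right) auto
    finally show ?thesis using True by simp
  qed (use z j in auto)
qed

lemma spectral_family_eigenvalue:
  assumes E: "spectral_family D X E" and v: "X *v v = \<mu> *s v" and "v \<noteq> 0"
  shows "\<exists>i\<le>D. \<mu> = theta D i"
proof (rule ccontr)
  assume "\<not> ?thesis"
  then have "(\<Sum>i\<le>D. E i *v v) = 0"
    using spectral_family_apply_eigenvector [OF E v] by (intro sum.neutral) auto
  then show False using E \<open>v \<noteq> 0\<close> by (simp add: spectral_family_def)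
qed

lemma spectral_family_invariant:
  assumes E: "spectral_family D X E" and "vec.subspace W" "invariant X W" "w \<in> W" "i \<le> D"
  shows "E i *v w \<in> W"
  using assms
  by (intro eigencomponents_in_invariant_subspace [of "{..D}" W X "theta D" "\<lambda>i. E i *v w"])
    (auto simp: spectral_family_def inj_on_def)

text \<open>\<open>E j\<close> kills the components \<open>E i *v v\<close> with
  \<open>i \<noteq> j\<close> and fixes \<open>E j *v v\<close>.\<close>

lemma spectral_family_mult_commute:
  assumes E: "spectral_family D X E" and j: "j \<le> D"
  shows "E j *v (X *v v) = theta D j *s (E j *v v)"
proof -
  have "E j *v (X *v v) = E j *v (X *v (\<Sum>i\<le>D. E i *v v))"
    using E by (simp add: spectral_family_def)
  also have "\<dots> = (\<Sum>i\<le>D. theta D i *s (E j *v (E i *v v)))"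
    unfolding mv_sum using E by (intro sum.cong) (auto simp: spectral_family_def vector_scalar_commute)
  also have "\<dots> = (\<Sum>i\<le>D. if i = j then theta D j *s (E j *v v) else 0)"
  proof (intro sum.cong refl)
    fix i assume "i \<in> {..D}"
    then have "E j *v (E i *v v) = (if theta D i = theta D j then E i *v v else 0)"
      using E by (intro spectral_family_apply_eigenvector [OF E _ j]) (auto simp: spectral_family_def)
    then show "theta D i *s (E j *v (E i *v v)) = (if i = j then theta D j *s (E j *v v) else 0)"
      by simp
  qed
  finally show ?thesis using j by simp
qed

text \<open>Links eigenvectors in \<open>W\<close> with the images under idempotents by which
  endpoint and diameter are defined.\<close>

lemma weight_support_iff_image:
  fixes W :: "'n::finite cvec set"
  assumes E: "spectral_family D X E" and W: "vec.subspace W" "invariant X W" and i: "i \<le> D"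
  shows "i \<in> weight_support D X W \<longleftrightarrow> mat_image (E i) W \<noteq> {0}"
proof
  assume "i \<in> weight_support D X W"
  then obtain w where w: "w \<in> W" "w \<noteq> 0" "X *v w = theta D i *s w"
    by (auto simp: weight_support_def)
  then have "E i *v w = w" using spectral_family_apply_eigenvector [OF E w(3) i] by simp
  then show "mat_image (E i) W \<noteq> {0}" using w by (force simp: mat_image_def)
next
  assume "mat_image (E i) W \<noteq> {0}"
  moreover have "0 \<in> mat_image (E i) W"
    using vec.subspace_0 [OF W(1)] by (force simp: mat_image_def)
  ultimately obtain w where "w \<in> W" "E i *v w \<noteq> 0" by (auto simp: mat_image_def)
  moreover have "X *v (E i *v w) = theta D i *s (E i *v w)"
    using E i by (simp add: spectral_family_def)
  ultimately show "i \<in> weight_support D X W"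
    using spectral_family_invariant [OF E W _ i] i by (auto simp: weight_support_def)
qed

subsection \<open>Triples with the commutation relations of su(2)\<close>

text \<open>\<open>c\<close> is either square root of -1. Keeping it a parameter makes the exchange
  of \<open>Y\<close> and \<open>Z\<close> an instance of the same locale, with
  \<open>- c\<close>.\<close>

locale su2_triple =
  fixes c :: complex and X Y Z :: "complex ^ 'm ^ 'm"
  assumes c2: "c * c = -1"
    and XY: "\<And>v. X *v (Y *v v) = Y *v (X *v v) + (2 * c) *s (Z *v v)"
    and YZ: "\<And>v. Y *v (Z *v v) = Z *v (Y *v v) + (2 * c) *s (X *v v)"
    and ZX: "\<And>v. Z *v (X *v v) = X *v (Z *v v) + (2 * c) *s (Y *v v)"
begin

lemma rotate: "su2_triple c Y Z X"
  by (unfold_locales) (rule c2 YZ ZX XY)+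

lemma swap: "su2_triple (- c) X Z Y"
  by (unfold_locales) (simp_all add: c2 XY YZ ZX)

text \<open>\<open>raise\<close> and \<open>lower\<close> are the ladder operators of
  \<open>X\<close>: twice the standard generators e and f of sl2, with \<open>X\<close> as h. Hence
  the factor 4 in \<open>raise_lower\<close>.\<close>

definition raise :: "complex ^ 'm \<Rightarrow> complex ^ 'm" where
  "raise v = Y *v v + c *s (Z *v v)"

definition lower :: "complex ^ 'm \<Rightarrow> complex ^ 'm" where
  "lower v = Y *v v - c *s (Z *v v)"

lemma c_nonzero: "c \<noteq> 0"
  using c2 by auto

lemmas mv_distribs = matrix_vector_right_distrib matrix_vector_mult_diff_distrib vector_scalar_commute
  vec.scale_right_distrib vec.scale_left_distrib vec.scale_right_diff_distrib vec.scale_left_diff_distrib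

lemma mult_raise: "X *v raise v = raise (X *v v) + 2 *s raise v"
proof -
  have "(X *v raise v) $ i = (raise (X *v v) + 2 *s raise v) $ i" for i
    using arg_cong [OF XY [of v], of "\<lambda>w. w $ i"] arg_cong [OF ZX [of v], of "\<lambda>w. w $ i"] c2
    by (simp add: raise_def mv_distribs) algebra
  then show ?thesis by (simp add: vec_eq_iff)
qed

lemma mult_lower: "X *v lower v = lower (X *v v) - 2 *s lower v"
proof -
  have "(X *v lower v) $ i = (lower (X *v v) - 2 *s lower v) $ i" for i
    using arg_cong [OF XY [of v], of "\<lambda>w. w $ i"] arg_cong [OF ZX [of v], of "\<lambda>w. w $ i"] c2
    by (simp add: lower_def mv_distribs) algebra
  then show ?thesis by (simp add: vec_eq_iff)
qed

lemma raise_lower: "raise (lower v) = lower (raise v) + 4 *s (X *v v)"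
proof -
  have "raise (lower v) $ i = (lower (raise v) + 4 *s (X *v v)) $ i" for i
    using arg_cong [OF YZ [of v], of "\<lambda>w. w $ i"] c2
    by (simp add: raise_def lower_def mv_distribs) algebra
  then show ?thesis by (simp add: vec_eq_iff)
qed

lemma raise_scale: "raise (a *s v) = a *s raise v" and lower_scale: "lower (a *s v) = a *s lower v"
  by (simp_all add: raise_def lower_def mv_distribs mult.commute)

lemma raise_add: "raise (v + w) = raise v + raise w" and lower_add: "lower (v + w) = lower v + lower w"
  by (simp_all add: raise_def lower_def mv_distribs)

lemma Y_raise_lower: "Y *v v = (1/2) *s (raise v + lower v)"
  by (simp add: vec_eq_iff raise_def lower_def)

lemma Z_raise_lower: "Z *v v = (1 / (2 * c)) *s (raise v - lower v)"
  using c_nonzero by (simp add: vec_eq_iff raise_def lower_def)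

text \<open>Moving \<open>raise\<close> past \<open>k + 1\<close> copies of \<open>lower\<close>
  adds up \<open>4 * (\<mu> - 2 * j)\<close> for \<open>j = 0, ..., k\<close>, which is
  \<open>4 * (k + 1) * (\<mu> - k)\<close>.\<close>

lemma string:
  assumes "X *v u = \<mu> *s u" "raise u = 0"
  shows "X *v (lower ^^ k) u = (\<mu> - 2 * of_nat k) *s (lower ^^ k) u"
    and "raise ((lower ^^ Suc k) u) = (4 * of_nat (Suc k) * (\<mu> - of_nat k)) *s (lower ^^ k) u"
proof -
  show wt: "X *v (lower ^^ k) u = (\<mu> - 2 * of_nat k) *s (lower ^^ k) u" for k
  proof (induction k)
    case (Suc k)
    have "X *v (lower ^^ Suc k) u = (\<mu> - 2 * of_nat k - 2) *s (lower ^^ Suc k) u"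
      unfolding funpow.simps o_apply mult_lower Suc lower_scale
      by (simp only: vec.scale_left_diff_distrib)
    then show ?case by (simp add: algebra_simps)
  qed (use assms in simp)
  show "raise ((lower ^^ Suc k) u) = (4 * of_nat (Suc k) * (\<mu> - of_nat k)) *s (lower ^^ k) u"
  proof (induction k)
    case 0
    show ?case
      using raise_lower [of u] assms by (simp add: lower_def)
  next
    case (Suc k)
    have "raise ((lower ^^ Suc (Suc k)) u)
      = lower (raise ((lower ^^ Suc k) u)) + 4 *s (X *v (lower ^^ Suc k) u)"
      by (simp add: raise_lower)
    also have "\<dots> = (4 * of_nat (Suc k) * (\<mu> - of_nat k) + 4 * (\<mu> - 2 * of_nat (Suc k))) *s (lower ^^ Suc k) u"
      unfolding Suc wt by (simp only: lower_scale vec.scale_left_distrib) simp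
    also have "4 * of_nat (Suc k) * (\<mu> - of_nat k) + 4 * (\<mu> - 2 * of_nat (Suc k))
      = 4 * of_nat (Suc (Suc k)) * (\<mu> - of_nat (Suc k))"
      by (simp add: algebra_simps)
    finally show ?case .
  qed
qed

text \<open>Eigenvalues decrease as indices grow, so a nonzero \<open>raise u\<close> would have
  index \<open>r - 1\<close>. This lies below the support, and for \<open>r = 0\<close> there is no
  such index.\<close>

lemma raise_top_zero:
  assumes E: "spectral_family D X E" and inv: "\<And>w. w \<in> W \<Longrightarrow> raise w \<in> W"
    and u: "u \<in> W" "X *v u = theta D r *s u" and top: "\<And>i. i \<in> weight_support D X W \<Longrightarrow> r \<le> i"
  shows "raise u = 0"
proof (rule ccontr)
  assume nz: "raise u \<noteq> 0"
  have eig: "X *v raise u = (theta D r + 2) *s raise u"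
    by (simp add: mult_raise u raise_scale vec.scale_left_distrib)
  obtain i where i: "i \<le> D" "theta D r + 2 = theta D i"
    using spectral_family_eigenvalue [OF E eig nz] by auto
  have "theta D r = theta D (Suc i)"
    using i(2) by (simp add: theta_Suc algebra_simps)
  then have "Suc i = r" by simp
  moreover have "i \<in> weight_support D X W"
    using i(1) nz eig [unfolded i(2)] inv [OF u(1)] by (auto simp: weight_support_def)
  ultimately show False using top by force
qed

text \<open>\<open>Y\<close> and \<open>Z\<close> are recovered from the ladder operators because
  \<open>c\<close> is nonzero.\<close>

lemma invariant_raise_lower:
  assumes "vec.subspace U"
  shows "(\<forall>M\<in>{X, Y, Z}. invariant M U) \<longleftrightarrow>
    (\<forall>v\<in>U. X *v v \<in> U \<and> raise v \<in> U \<and> lower v \<in> U)" (is "?L \<longleftrightarrow> ?R")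
proof
  show ?R if ?L
    using that assms unfolding invariant_def raise_def lower_def
    by (auto intro!: vec.subspace_add vec.subspace_diff vec.subspace_scale)
  show ?L if R: ?R
  proof -
    have "Y *v v \<in> U" "Z *v v \<in> U" if "v \<in> U" for v
      using that R unfolding Y_raise_lower Z_raise_lower
      by (metis assms vec.subspace_add vec.subspace_diff vec.subspace_scale)+
    then show ?thesis using R by (simp add: invariant_def)
  qed
qed

text \<open>The dimension formula pins down \<open>r\<close> by \<open>W\<close> alone, and so ties
  together the supports of the three matrices of a triple.\<close>

lemma irreducible_support_dim:
  assumes E: "spectral_family D X E" and irr: "irreducible_under {X, Y, Z} W"
  defines "r \<equiv> Min (weight_support D X W)"
  shows "2 * r \<le> D" "weight_support D X W = {r..D - r}" "vec.dim W = Suc (D - 2 * r)"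
proof -
  have sub: "vec.subspace W" and ne: "W \<noteq> {0}" and inv: "\<And>M. M \<in> {X, Y, Z} \<Longrightarrow> invariant M W"
    using irr by (auto simp: irreducible_under_def)
  have closed: "X *v w \<in> W" "raise w \<in> W" "lower w \<in> W" if "w \<in> W" for w
    using invariant_raise_lower [OF sub] inv that by blast+
  let ?S = "weight_support D X W"
  have fin: "finite ?S" by (rule finite_subset [of _ "{..D}"]) (auto simp: weight_support_def)
  obtain w where w: "w \<in> W" "w \<noteq> 0" using ne vec.subspace_0 [OF sub] by blast
  have "\<exists>i\<le>D. E i *v w \<noteq> 0"
    using w(2) E by (metis (no_types, lifting) atMost_iff spectral_family_def sum.neutral)
  then obtain i where i: "i \<le> D" "E i *v w \<noteq> 0" by auto
  then have "i \<in> ?S"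
    using E spectral_family_invariant [OF E sub inv w(1) i(1)]
    by (auto simp: weight_support_def spectral_family_def)
  then have "r \<in> ?S" and top: "\<And>i. i \<in> ?S \<Longrightarrow> r \<le> i"
    unfolding r_def using fin Min_in [of ?S] by (blast, auto)
  then obtain u where u: "u \<in> W" "u \<noteq> 0" "X *v u = theta D r *s u" and "r \<le> D"
    by (auto simp: weight_support_def)
  \<comment> \<open>the string of \<open>u\<close> under \<open>lower\<close> is invariant, hence all of \<open>W\<close>; the step at which it
    stops forces its highest weight to be \<open>m\<close>\<close>
  have ru: "raise u = 0" by (rule raise_top_zero [OF E closed(2) u(1,3) top])
  define x where "x k = (lower ^^ k) u" for k
  have Xx: "X *v x k = (theta D r - 2 * of_nat k) *s x k"
    and Rx: "raise (x (Suc k)) = (4 * of_nat (Suc k) * (theta D r - of_nat k)) *s x k" for k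
    unfolding x_def by (rule string [OF u(3) ru])+
  have Lx: "lower (x k) = x (Suc k)" for k by (simp add: x_def)
  have xW: "x k \<in> W" for k by (induction k) (use u closed in \<open>simp_all add: x_def\<close>)
  \<comment> \<open>Otherwise \<open>x (Suc D)\<close> would be an eigenvector for
    \<open>theta D (r + Suc D)\<close>, beyond the last eigenvalue.\<close>
  have "\<exists>N. x N = 0"
  proof (rule ccontr)
    assume "\<nexists>N. x N = 0"
    then obtain i where i: "i \<le> D" "theta D r - 2 * of_nat (Suc D) = theta D i"
      using spectral_family_eigenvalue [OF E Xx] by blast
    then have "r + Suc D = i" by (simp only: flip: theta_add) simp
    then show False using i(1) by simp
  qed
  define N where "N = (LEAST N. x N = 0)"
  have N: "x N = 0" "\<And>k. k < N \<Longrightarrow> x k \<noteq> 0"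
    using LeastI_ex [OF \<open>\<exists>N. x N = 0\<close>] not_less_Least by (auto simp: N_def)
  have "N \<noteq> 0" using N(1) u(2) by (auto simp: x_def intro: ccontr)
  then obtain m where m: "N = Suc m" using not0_implies_Suc by blast
  have low0: "raise (x 0) = 0" using ru by (simp add: x_def)
  have "(4 * of_nat (Suc m) * (theta D r - of_nat m)) *s x m = 0"
    using Rx [of m] N(1) m by (simp add: raise_def)
  then have th: "theta D r = of_nat m"
    using N(2) [of m] m by (simp del: of_nat_Suc)
  then have "complex_of_nat D = of_nat (m + 2 * r)"
    by (simp add: theta_def algebra_simps)
  then have Dm: "D = m + 2 * r" by (simp only: of_nat_eq_iff)
  have Xx': "X *v x k = theta D (r + k) *s x k" for k
    by (simp only: Xx theta_add)
  have indep: "inj_on x {..m}" "vec.independent (x ` {..m})"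
    using eigenvectors_independent [of "{..m}" "\<lambda>k. theta D (r + k)" X x] Xx' N(2) m
    by (auto simp: inj_on_def)
  let ?U = "vec.span (x ` {..m})"
  have span_x: "x k \<in> ?U" if "k \<le> m" for k using that by (auto intro: vec.span_base)
  have "X *v v \<in> ?U \<and> raise v \<in> ?U \<and> lower v \<in> ?U" if "v \<in> ?U" for v
    using that
  proof (induction rule: vec.span_induct_alt)
    case base
    show ?case by (simp add: raise_def lower_def vec.span_zero)
  next
    case (step a y z)
    then obtain k where k: "k \<le> m" "y = x k" by auto
    have "X *v y \<in> ?U"
      unfolding k Xx' using k by (intro vec.span_scale span_x)
    moreover have "raise y \<in> ?U"
    proof (cases k)
      case 0
      then show ?thesis using k low0 by (simp add: vec.span_zero)
    next
      case (Suc l)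
      then show ?thesis unfolding k(2) Suc Rx using k(1) Suc by (intro vec.span_scale span_x) simp
    qed
    moreover have "lower y \<in> ?U"
      using k N(1) m span_x
      by (cases "k = m") (auto simp: Lx vec.span_zero)
    ultimately show ?case using step
      by (simp add: raise_add lower_add raise_scale lower_scale matrix_vector_right_distrib
          vector_scalar_commute vec.span_add vec.span_scale)
  qed
  then have "\<forall>M\<in>{X, Y, Z}. invariant M ?U"
    using invariant_raise_lower [OF vec.subspace_span] by blast
  moreover have "?U \<subseteq> W" using xW by (intro vec.span_minimal sub) auto
  moreover have "?U \<noteq> {0}" using span_x [of 0] u(2) by (auto simp: x_def)
  ultimately have UW: "?U = W"
    using irr vec.subspace_span unfolding irreducible_under_def by blast
  show "2 * r \<le> D" using Dm by simp
  show "vec.dim W = Suc (D - 2 * r)"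
    using vec.dim_span_eq_card_independent [OF indep(2)] UW card_image [OF indep(1)] Dm by simp
  have "i \<in> ?S" if "i \<in> {r..r + m}" for i
  proof -
    from that have "X *v x (i - r) = theta D i *s x (i - r)" "x (i - r) \<noteq> 0"
      using Xx' [of "i - r"] N(2) m by auto
    then show ?thesis using that Dm xW by (auto simp: weight_support_def)
  qed
  moreover have "i \<in> {r..r + m}" if i: "i \<in> ?S" for i
  proof (rule ccontr)
    assume i': "i \<notin> {r..r + m}"
    obtain w where w: "w \<in> W" "w \<noteq> 0" "X *v w = theta D i *s w" and iD: "i \<le> D"
      using i by (auto simp: weight_support_def)
    \<comment> \<open>For \<open>i\<close> outside \<open>r..r + m\<close>, \<open>E i\<close> kills
      each string vector and hence their span \<open>W\<close>; yet it must fix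
      \<open>w\<close>.\<close>
    have "E i *v w = 0" using w(1) unfolding UW [symmetric]
    proof (induction rule: vec.span_induct_alt)
      case (step a y z)
      then obtain k where k: "k \<le> m" "y = x k" by auto
      have "E i *v y = 0"
        using spectral_family_apply_eigenvector [OF E Xx' iD, of k] k i' by auto
      then show ?case using step
        by (simp add: matrix_vector_right_distrib vector_scalar_commute)
    qed simp
    then show False using spectral_family_apply_eigenvector [OF E w(3) iD] w(2) by simp
  qed
  moreover have "D - r = r + m" using Dm by simp
  ultimately show "?S = {r..D - r}" by (metis subsetI subset_antisym)
qed

end

section \<open>Ladder operators and eigencomponents\<close>

context su2_triple
begin

lemma raise_sum: "raise (\<Sum>i\<in>S. f i) = (\<Sum>i\<in>S. raise (f i))"
  and lower_sum: "lower (\<Sum>i\<in>S. f i) = (\<Sum>i\<in>S. lower (f i))"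
  by (simp_all add: raise_def lower_def mv_sum vec.scale_sum_right sum.distrib sum_subtractf)

context
  fixes D E
  assumes E: "spectral_family D X E"
begin

lemma mult_raise_component:
  assumes "i \<le> D" shows "X *v raise (E i *v v) = (theta D i + 2) *s raise (E i *v v)"
  using E assms
  by (simp add: spectral_family_def mult_raise raise_scale vec.scale_left_distrib)

lemma mult_lower_component:
  assumes "i \<le> D" shows "X *v lower (E i *v v) = (theta D i - 2) *s lower (E i *v v)"
  using E assms
  by (simp add: spectral_family_def mult_lower lower_scale vec.scale_left_diff_distrib)

text \<open>\<open>raise\<close> sends the eigenspace of index \<open>i\<close> into that of index
  \<open>i - 1\<close>, so the component of index \<open>j\<close> of \<open>raise v\<close> comes
  from the component \<open>Suc j\<close> of \<open>v\<close> alone.\<close>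

lemma raise_component_Suc:
  assumes "j < D" shows "raise (E (Suc j) *v v) = E j *v raise v"
proof -
  have "E j *v raise v = E j *v raise (\<Sum>i\<le>D. E i *v v)"
    using E by (simp add: spectral_family_def)
  also have "\<dots> = (\<Sum>i\<le>D. E j *v raise (E i *v v))"
    by (simp add: raise_sum mv_sum)
  also have "\<dots> = (\<Sum>i\<le>D. if i = Suc j then raise (E i *v v) else 0)"
    using assms
    by (intro sum.cong refl)
      (simp add: spectral_family_apply_eigenvector [OF E mult_raise_component])
  finally show ?thesis using assms by simp
qed

lemma lower_component:
  assumes "j < D" shows "lower (E j *v v) = E (Suc j) *v lower v"
proof -
  have "E (Suc j) *v lower v = E (Suc j) *v lower (\<Sum>i\<le>D. E i *v v)"
    using E by (simp add: spectral_family_def)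
  also have "\<dots> = (\<Sum>i\<le>D. E (Suc j) *v lower (E i *v v))"
    by (simp add: lower_sum mv_sum)
  also have "\<dots> = (\<Sum>i\<le>D. if i = j then lower (E i *v v) else 0)"
    using assms
    by (intro sum.cong refl)
      (auto simp: spectral_family_apply_eigenvector [OF E mult_lower_component])
  finally show ?thesis using assms by simp
qed

text \<open>A nonzero value would have the eigenvalue \<open>theta D 0 + 2\<close>, which does not
  occur.\<close>

lemma raise_component_0: "raise (E 0 *v v) = 0"
  using spectral_family_eigenvalue [OF E mult_raise_component] by fastforce

lemma lower_component_top: "lower (E D *v v) = 0"
  using spectral_family_eigenvalue [OF E mult_lower_component] by fastforce

end

end

section \<open>The tridiagonal action on the components of a highest weight vector\<close>

lemma sum_B_tridiag:
  fixes v :: "nat \<Rightarrow> 'n::finite cvec"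
  assumes "j \<le> d"
  shows "(\<Sum>i=0..d. B_tridiag d i j *s v i)
    = (case j of 0 \<Rightarrow> 0 | Suc l \<Rightarrow> of_nat (d - l) *s v l) + (if j < d then of_nat (Suc j) *s v (Suc j) else 0)"
proof -
  have "(\<Sum>i=0..d. B_tridiag d i j *s v i)
    = (\<Sum>i=0..d. (if j = Suc i then of_nat (d - i) *s v i else 0) + (if i = Suc j then of_nat i *s v i else 0))"
    by (intro sum.cong) (auto simp: B_tridiag_def)
  also have "\<dots> = (\<Sum>i=0..d. if j = Suc i then of_nat (d - i) *s v i else 0)
      + (\<Sum>i=0..d. if i = Suc j then of_nat i *s v i else 0)"
    by (rule sum.distrib)
  also have "(\<Sum>i=0..d. if i = Suc j then of_nat i *s v i else 0) = (if j < d then of_nat (Suc j) *s v (Suc j) else 0)"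
    by (simp add: sum.delta del: of_nat_Suc)
  also have "(\<Sum>i=0..d. if j = Suc i then of_nat (d - i) *s v i else 0) = (case j of 0 \<Rightarrow> 0 | Suc l \<Rightarrow> of_nat (d - l) *s v l)"
    using assms by (cases j) (simp_all add: sum.delta')
  finally show ?thesis .
qed

text \<open>All six assertions are instances of this one: rotating the triple chooses which matrix
  plays \<open>X\<close>, and swapping (with \<open>- c\<close>) chooses which of the other two
  supplies the components.\<close>

lemma su2_triple_represents:
  fixes X Y Z :: "'n::finite cmat"
  assumes triple: "su2_triple c X Y Z" and irr: "irreducible_under {X, Y, Z} W"
    and E: "spectral_family D X E" and F: "spectral_family D Y F"
    and rD: "2 * r \<le> D" and dim: "vec.dim W = Suc (D - 2 * r)"
    and supp: "weight_support D X W = {r..D - r}" "weight_support D Y W = {r..D - r}"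
    and u: "u \<in> W" "u \<noteq> 0" "X *v u = theta D r *s u"
  shows "represents W (D - 2 * r) (B_tridiag (D - 2 * r)) X (\<lambda>i. F (r + i) *v u)"
proof -
  interpret su2_triple c X Y Z by fact
  interpret Y: su2_triple c Y Z X by (rule rotate)
  define d where "d = D - 2 * r"
  define v where "v k = F (r + k) *v u" for k
  have D: "D = d + 2 * r" using rD by (simp add: d_def)
  have sub: "vec.subspace W" and inv: "\<And>M. M \<in> {X, Y, Z} \<Longrightarrow> invariant M W"
    using irr by (auto simp: irreducible_under_def)
  have th: "theta D (r + k) = of_nat d - 2 * of_nat k" for k
    by (simp add: theta_def D)
  have thr: "theta D r = of_nat d" by (simp add: theta_def D)
  have "raise u = 0"
    using supp(1) u inv invariant_raise_lower [OF sub]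
    by (intro raise_top_zero [OF E _ u(1,3)]) auto
  then have Yu: "Y *v u = - (c *s (Z *v u))" by (simp add: raise_def eq_neg_iff_add_eq_0)
  have Zu: "Z *v u = c *s (Y *v u)" by (simp add: Yu c2)
  \<comment> \<open>on the highest weight vector the ladder operators of \<open>Y\<close> are affine in \<open>Y\<close>, which turns
    the components of \<open>u\<close> into a ladder with explicit coefficients\<close>
  have up: "Y.raise u = c *s (Y *v u + of_nat d *s u)" and down: "Y.lower u = c *s (Y *v u - of_nat d *s u)"
    by (simp_all only: Y.raise_def Y.lower_def Zu u(3) thr vec.scale_right_distrib vec.scale_right_diff_distrib)
  \<comment> \<open>A nonzero component would be an eigenvector of \<open>Y\<close> in
    \<open>W\<close> with index outside the support. This is what stops the ladder at both
    ends.\<close>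
  have F0: "F j *v u = 0" if "j \<le> D" "j \<notin> {r..D - r}" for j
  proof (rule ccontr)
    assume "F j *v u \<noteq> 0"
    then have "j \<in> weight_support D Y W"
      using that F spectral_family_invariant [OF F sub inv u(1)]
      by (auto simp: weight_support_def spectral_family_def)
    then show False using supp that by simp
  qed
  have raise_F: "Y.raise (F (Suc j) *v u) = (c * (theta D j + of_nat d)) *s (F j *v u)" if "j < D" for j
  proof -
    have "Y.raise (F (Suc j) *v u) = c *s (theta D j *s (F j *v u) + of_nat d *s (F j *v u))"
      using that spectral_family_mult_commute [OF F, of j u]
      by (simp add: Y.raise_component_Suc [OF F] up vector_scalar_commute matrix_vector_right_distrib)
    then show ?thesis by (simp only: vec.scale_scale flip: vec.scale_left_distrib)
  qed
  have lower_F: "Y.lower (F j *v u) = (c * (theta D (Suc j) - of_nat d)) *s (F (Suc j) *v u)" if "j < D" for j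
  proof -
    have "Y.lower (F j *v u) = c *s (theta D (Suc j) *s (F (Suc j) *v u) - of_nat d *s (F (Suc j) *v u))"
      using that spectral_family_mult_commute [OF F, of "Suc j" u]
      by (simp add: Y.lower_component [OF F] down vector_scalar_commute matrix_vector_mult_diff_distrib)
    then show ?thesis by (simp only: vec.scale_scale flip: vec.scale_left_diff_distrib)
  qed
  \<comment> \<open>For \<open>r > 0\<close> the image is a multiple of
    \<open>F (r - 1) *v u\<close>, zero by \<open>F0\<close>; for \<open>r = 0\<close> there is no
    higher eigenvalue.\<close>
  have raise_0: "Y.raise (v 0) = 0"
  proof (cases r)
    case 0
    then show ?thesis by (simp add: v_def Y.raise_component_0 [OF F])
  next
    case (Suc l)
    then show ?thesis using raise_F [of l] F0 [of l] D by (simp add: v_def)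
  qed
  have raise_v: "Y.raise (v (Suc k)) = (2 * c * of_nat (d - k)) *s v k" if "k < d" for k
  proof -
    have "Y.raise (v (Suc k)) = (c * (theta D (r + k) + of_nat d)) *s v k"
      unfolding v_def add_Suc_right by (rule raise_F) (use that D in simp)
    \<comment> \<open>The factors \<open>d - k\<close> here and \<open>Suc k\<close> in
      \<open>lower_v\<close> become the off-diagonal entries of the tridiagonal matrix.\<close>
    moreover have "c * (theta D (r + k) + of_nat d) = 2 * c * of_nat (d - k)"
      unfolding th using that by (simp add: of_nat_diff algebra_simps)
    ultimately show ?thesis by (simp only:)
  qed
  have lower_d: "Y.lower (v d) = 0"
  proof (cases r)
    case 0
    then show ?thesis using D Y.lower_component_top [OF F] by (simp add: v_def)
  next
    case (Suc l)
    then show ?thesis using lower_F [of "r + d"] F0 [of "Suc (r + d)"] D by (simp add: v_def)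
  qed
  have lower_v: "Y.lower (v k) = (- 2 * c * of_nat (Suc k)) *s v (Suc k)" if "k < d" for k
  proof -
    have "Y.lower (v k) = (c * (theta D (r + Suc k) - of_nat d)) *s v (Suc k)"
      unfolding v_def add_Suc_right by (rule lower_F) (use that D in simp)
    moreover have "c * (theta D (r + Suc k) - of_nat d) = - 2 * c * of_nat (Suc k)"
      unfolding th by (simp add: algebra_simps)
    ultimately show ?thesis by (simp only:)
  qed
  have act: "X *v v j = (\<Sum>i=0..d. B_tridiag d i j *s v i)" if "j \<le> d" for j
  proof -
    have 1: "Y.raise (v j) = (2 * c) *s (case j of 0 \<Rightarrow> 0 | Suc l \<Rightarrow> of_nat (d - l) *s v l)"
    proof (cases j)
      case 0
      then show ?thesis by (simp add: raise_0)
    next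
      case (Suc l)
      then show ?thesis using raise_v [of l] that by (simp only: nat.case vec.scale_scale Suc_le_eq)
    qed
    have 2: "Y.lower (v j) = (- 2 * c) *s (if j < d then of_nat (Suc j) *s v (Suc j) else 0)"
    proof (cases "j < d")
      case True
      then show ?thesis using lower_v [OF True] by (simp only: if_True vec.scale_scale)
    next
      case False
      then show ?thesis using lower_d that by simp
    qed
    \<comment> \<open>In the rotated triple \<open>X\<close> stands in third place, so it is the
      difference of the ladder operators of \<open>Y\<close> divided by \<open>2 * c\<close>. The
      factors \<open>2 * c\<close> and \<open>- 2 * c\<close> of \<open>1\<close> and
      \<open>2\<close> then cancel.\<close>
    have "X *v v j = (1 / (2 * c)) *s (Y.raise (v j) - Y.lower (v j))"
      by (rule Y.Z_raise_lower)
    also have "\<dots> = (case j of 0 \<Rightarrow> 0 | Suc l \<Rightarrow> of_nat (d - l) *s v l) + (if j < d then of_nat (Suc j) *s v (Suc j) else 0)"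
      unfolding 1 2 using c_nonzero by (simp add: vec_eq_iff field_simps del: of_nat_Suc)
    finally show ?thesis using sum_B_tridiag [OF that, of v] by simp
  qed
  let ?U = "vec.span (v ` {0..d})"
  have span_v: "v k \<in> ?U" if "k \<le> d" for k
    using that by (auto intro: vec.span_base)
  have "Y *v w \<in> ?U \<and> Y.raise w \<in> ?U \<and> Y.lower w \<in> ?U" if "w \<in> ?U" for w
    using that
  proof (induction rule: vec.span_induct_alt)
    case base
    show ?case by (simp add: Y.raise_def Y.lower_def vec.span_zero)
  next
    case (step a y z)
    then obtain k where k: "k \<le> d" "y = v k" by auto
    have "Y *v y \<in> ?U"
      using span_v [OF k(1)] F k(1) D unfolding k(2) v_def
      by (simp add: spectral_family_def vec.span_scale)
    moreover have "Y.raise y \<in> ?U"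
    proof (cases k)
      case 0
      then show ?thesis using k raise_0 by (simp add: vec.span_zero)
    next
      case (Suc l)
      then have "l < d" using k(1) by simp
      then show ?thesis unfolding k(2) Suc raise_v [OF \<open>l < d\<close>] by (intro vec.span_scale span_v) simp
    qed
    moreover have "Y.lower y \<in> ?U"
    proof (cases "k < d")
      case True
      then show ?thesis unfolding k(2) lower_v [OF True] by (intro vec.span_scale span_v) simp
    next
      case False
      then show ?thesis using k lower_d by (simp add: vec.span_zero)
    qed
    ultimately show ?case using step
      by (simp add: Y.raise_add Y.lower_add Y.raise_scale Y.lower_scale matrix_vector_right_distrib
          vector_scalar_commute vec.span_add vec.span_scale)
  qed
  then have "\<forall>M\<in>{X, Y, Z}. invariant M ?U"
    using Y.invariant_raise_lower [OF vec.subspace_span] by blast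
  moreover have vW: "v k \<in> W" if "k \<le> d" for k
    unfolding v_def using that D by (intro spectral_family_invariant [OF F sub inv u(1)]) auto
  then have "?U \<subseteq> W" by (intro vec.span_minimal sub) auto
  \<comment> \<open>\<open>u\<close> is the sum of its components, and those outside the span's
    index range vanish. Thus the span is a nonzero submodule.\<close>
  moreover have "u \<in> ?U"
  proof -
    have "F j *v u \<in> ?U" if "j \<le> D" for j
      using F0 [OF that] span_v [of "j - r"] D vec.span_zero
      by (cases "j \<in> {r..D - r}") (auto simp: v_def)
    then have "(\<Sum>j\<le>D. F j *v u) \<in> ?U" by (intro vec.span_sum) auto
    then show ?thesis using F by (simp add: spectral_family_def)
  qed
  ultimately have UW: "?U = W"
    using irr vec.subspace_span u(2) unfolding irreducible_under_def by blast
  \<comment> \<open>\<open>d + 1\<close> vectors that span a space of dimension \<open>d + 1\<close>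
    are distinct and independent; in particular no component is zero.\<close>
  have "vec.dim W \<le> card (v ` {0..d})"
    using UW by (metis finite_atLeastAtMost finite_imageI vec.dim_le_card vec.span_superset order_refl)
  moreover have "card (v ` {0..d}) \<le> card {0..d}" by (rule card_image_le) simp
  ultimately have card: "card (v ` {0..d}) = card {0..d}" and card': "card (v ` {0..d}) \<le> vec.dim W"
    using dim by (simp_all add: d_def)
  have "inj_on v {0..d}" by (rule eq_card_imp_inj_on) (use card in simp_all)
  moreover have "vec.independent (v ` {0..d})"
    using vW UW card' by (intro vec.card_le_dim_spanning [of _ W]) auto
  ultimately show ?thesis
    using UW act by (simp add: represents_def basis_of_def flip: d_def v_def)
qed

subsection \<open>The matrices of the cube\<close>

definition flip :: "'n \<Rightarrow> 'n::finite vertex \<Rightarrow> 'n vertex" where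
  "flip k y = (\<chi> l. if l = k then \<not> y $ l else y $ l)"

definition weight :: "'n::finite vertex \<Rightarrow> nat" where
  "weight y = card {k. y $ k}"

text \<open>The contribution of a coordinate with value \<open>b\<close> to the eigenvalue of
  \<open>Astar_mat\<close>.\<close>

definition spin :: "bool \<Rightarrow> complex" where
  "spin b = (if b then -1 else 1)"

lemma flip_nth: "flip k y $ l = (if l = k then \<not> y $ l else y $ l)"
  by (simp add: flip_def)

lemma flip_flip [simp]: "flip k (flip k y) = y"
  by (simp add: vec_eq_iff flip_nth)

lemma flip_commute: "flip k (flip l y) = flip l (flip k y)"
  by (simp add: vec_eq_iff flip_nth)

lemma spin_simps [simp]: "spin (\<not> b) = - spin b" "spin b * spin b = 1" "spin b * (spin b * x) = x"
  by (auto simp: spin_def)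

lemma inj_flip: "inj (\<lambda>k. flip k y)"
proof (rule injI)
  fix k l assume "flip k y = flip l y"
  then have "flip k y $ k = flip l y $ k" by simp
  then show "k = l" by (simp add: flip_nth split: if_splits)
qed

lemma cube_adj_flip: "cube_adj y z \<longleftrightarrow> (\<exists>k. z = flip k y)"
proof
  assume "cube_adj y z"
  then obtain k where k: "{l. y $ l \<noteq> z $ l} = {k}"
    by (auto simp: cube_adj_def card_1_singleton_iff)
  then have "z = flip k y" by (auto simp: vec_eq_iff flip_nth)
  then show "\<exists>k. z = flip k y" ..
next
  assume "\<exists>k. z = flip k y"
  then obtain k where "z = flip k y" ..
  then have "{l. y $ l \<noteq> z $ l} = {k}" by (auto simp: flip_nth)
  then show "cube_adj y z" by (simp add: cube_adj_def)
qed

lemma weight_flip: "weight (flip k y) = (if y $ k then weight y - 1 else Suc (weight y))"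
proof -
  have "{l. flip k y $ l} = (if y $ k then {l. y $ l} - {k} else insert k {l. y $ l})"
    by (auto simp: flip_nth)
  then show ?thesis by (auto simp: weight_def)
qed

text \<open>Clearing the true coordinates one at a time gives a path of length
  \<open>weight y\<close>; conversely an edge raises the weight by at most one.\<close>

lemma cube_dist_base: "cube_dist base_vertex y = weight y"
  unfolding cube_dist_def
proof (rule Least_equality)
  show "(cube_adj ^^ weight y) base_vertex y"
  proof (induction "weight y" arbitrary: y)
    case 0
    then have "y = base_vertex" by (simp add: weight_def base_vertex_def vec_eq_iff)
    then show ?case using 0 by simp
  next
    case (Suc n)
    then obtain k where "y $ k" unfolding weight_def
      by (metis (mono_tags, lifting) Collect_empty_eq card.empty nat.distinct(1))
    then have "n = weight (flip k y)" using Suc(2) by (simp add: weight_flip)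
    then have "(cube_adj ^^ n) base_vertex (flip k y)" using Suc(1) by blast
    moreover have "cube_adj (flip k y) y" by (metis cube_adj_flip flip_flip)
    ultimately have "(cube_adj ^^ Suc n) base_vertex y" by auto
    then show ?case using Suc(2) by simp
  qed
next
  fix n assume "(cube_adj ^^ n) base_vertex y"
  then show "weight y \<le> n"
  proof (induction n arbitrary: y)
    case 0
    then show ?case by (auto simp: weight_def base_vertex_def)
  next
    case (Suc n)
    then obtain z where z: "(cube_adj ^^ n) base_vertex z" "cube_adj z y" by auto
    then obtain k where "y = flip k z" by (auto simp: cube_adj_flip)
    then have "weight y \<le> Suc (weight z)" by (auto simp: weight_flip)
    then show ?case using Suc.IH [OF z(1)] by simp
  qed
qed

lemma weight_le: "weight (y :: 'n::finite vertex) \<le> CARD('n)"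
  unfolding weight_def by (rule card_mono) auto

lemma sum_spin: "(\<Sum>k\<in>UNIV. spin (y $ k)) = theta CARD('n) (weight y)" for y :: "'n::finite vertex"
proof -
  have "(\<Sum>k\<in>UNIV. spin (y $ k)) = (\<Sum>k\<in>UNIV. 1 - 2 * of_bool (y $ k))"
    by (intro sum.cong) (auto simp: spin_def)
  also have "\<dots> = of_nat CARD('n) - 2 * (\<Sum>k\<in>UNIV. of_bool (y $ k))"
    by (simp add: sum_subtractf sum_distrib_left)
  also have "(\<Sum>k\<in>UNIV. of_bool (y $ k)) = of_nat (weight y)"
    by (simp add: of_bool_def sum.If_cases weight_def)
  also have "of_nat CARD('n) - 2 * of_nat (weight y) = theta CARD('n) (weight y)"
    by (simp add: theta_def)
  finally show ?thesis .
qed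

section \<open>The three matrices as operators, and their commutators\<close>

lemma cscale_mv: "(c *\<^sub>M B) *v v = c *s (B *v v)"
  by (simp add: vec_eq_iff cscale_def matrix_vector_mult_def sum_distrib_left mult.assoc)

lemma A_mat_apply: "(A_mat *v v) $ y = (\<Sum>k\<in>UNIV. v $ flip k y)"
proof -
  have nbrs: "{z. cube_adj y z} = range (\<lambda>k. flip k y)"
    by (auto simp: cube_adj_flip)
  have "(A_mat *v v) $ y = (\<Sum>z\<in>UNIV. if cube_adj y z then v $ z else 0)"
    by (simp add: A_mat_def matrix_vector_mult_def if_distrib [of "\<lambda>a. a * _"] cong: if_cong)
  also have "\<dots> = (\<Sum>z\<in>range (\<lambda>k. flip k y). v $ z)"
    by (simp add: sum.If_cases nbrs)
  also have "\<dots> = (\<Sum>k\<in>UNIV. v $ flip k y)"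
    by (simp add: sum.reindex [OF inj_flip])
  finally show ?thesis .
qed

lemma Astar_mat_apply: "(Astar_mat *v v) $ y = (\<Sum>k\<in>UNIV. spin (y $ k)) * v $ y"
  by (simp add: Astar_mat_def matrix_vector_mult_def if_distrib [of "\<lambda>a. a * _"] sum_spin theta_def
      cube_dist_base cong: if_cong)

lemma spin_flip: "spin (flip k y $ l) = spin (y $ l) - (if k = l then 2 * spin (y $ k) else 0)"
  by (auto simp: flip_nth)

lemma sum_spin_flip: "(\<Sum>l\<in>UNIV. spin (flip k y $ l)) = (\<Sum>l\<in>UNIV. spin (y $ l)) - 2 * spin (y $ k)"
  by (simp add: spin_flip sum_subtractf)

text \<open>The definition of \<open>Aeps_mat\<close> solved for the commutator, as
  \<open>2 * \<i>\<close> times \<open>- \<i> / 2\<close> is 1.\<close>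

lemma A_Astar: "A_mat *v (Astar_mat *v v) = Astar_mat *v (A_mat *v v) + (2 * \<i>) *s (Aeps_mat *v v)"
  by (simp add: Aeps_mat_def cscale_mv matrix_vector_mult_diff_rdistrib vec_eq_iff flip: matrix_vector_mul_assoc)

text \<open>A flip changes the spin sum by \<open>- 2 * spin (y $ k)\<close>, and only this survives
  in the commutator. The three matrices are thus coordinate sums of Pauli matrices, this one with
  the sign reversed.\<close>

lemma Aeps_mat_apply: "(Aeps_mat *v v) $ y = \<i> * (\<Sum>k\<in>UNIV. spin (y $ k) * v $ flip k y)"
proof -
  have "(A_mat *v (Astar_mat *v v)) $ y
      = (Astar_mat *v (A_mat *v v)) $ y - 2 * (\<Sum>k\<in>UNIV. spin (y $ k) * v $ flip k y)"
    unfolding A_mat_apply Astar_mat_apply sum_spin_flip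
    by (simp only: left_diff_distrib sum_subtractf sum_distrib_left mult.assoc)
  then have "\<i> * (Aeps_mat *v v) $ y = - (\<Sum>k\<in>UNIV. spin (y $ k) * v $ flip k y)"
    using arg_cong [OF A_Astar [of v], of "\<lambda>w. w $ y"] by simp
  moreover have "\<i> * \<i> = -1" by simp
  ultimately show ?thesis by algebra
qed

lemma Astar_Aeps: "Astar_mat *v (Aeps_mat *v v) = Aeps_mat *v (Astar_mat *v v) + (2 * \<i>) *s (A_mat *v v)"
proof -
  have "(Aeps_mat *v (Astar_mat *v v)) $ y = (Astar_mat *v (Aeps_mat *v v)) $ y - 2 * \<i> * (A_mat *v v) $ y" for y
  proof -
    have "(Aeps_mat *v (Astar_mat *v v)) $ y
      = \<i> * (\<Sum>k\<in>UNIV. (\<Sum>l\<in>UNIV. spin (y $ l)) * (spin (y $ k) * v $ flip k y) - 2 * v $ flip k y)"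
      unfolding Aeps_mat_apply Astar_mat_apply sum_spin_flip by (simp add: algebra_simps)
    also have "\<dots> = (Astar_mat *v (Aeps_mat *v v)) $ y - 2 * \<i> * (A_mat *v v) $ y"
      unfolding sum_subtractf sum_distrib_left [symmetric] Aeps_mat_apply Astar_mat_apply A_mat_apply
      by (simp add: algebra_simps)
    finally show ?thesis .
  qed
  then show ?thesis by (simp add: vec_eq_iff)
qed

lemma Aeps_A: "Aeps_mat *v (A_mat *v v) = A_mat *v (Aeps_mat *v v) + (2 * \<i>) *s (Astar_mat *v v)"
proof -
  have "(A_mat *v (Aeps_mat *v v)) $ y = (Aeps_mat *v (A_mat *v v)) $ y - 2 * \<i> * (Astar_mat *v v) $ y" for y
  proof -
    have "(A_mat *v (Aeps_mat *v v)) $ y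
      = \<i> * (\<Sum>l\<in>UNIV. \<Sum>k\<in>UNIV. spin (flip l y $ k) * v $ flip k (flip l y))"
      unfolding Aeps_mat_apply A_mat_apply by (simp add: sum_distrib_left)
    also have "(\<Sum>l\<in>UNIV. \<Sum>k\<in>UNIV. spin (flip l y $ k) * v $ flip k (flip l y))
      = (\<Sum>k\<in>UNIV. \<Sum>l\<in>UNIV. spin (flip l y $ k) * v $ flip l (flip k y))"
      by (subst sum.swap) (subst flip_commute, rule refl)
    \<comment> \<open>The flip inside the spin matters only for \<open>l = k\<close>, where the two
      flips of the vertex cancel. These diagonal terms produce \<open>Astar_mat\<close>; the rest is
      \<open>Aeps_mat\<close> applied after \<open>A_mat\<close>.\<close>
    also have "\<dots> = (\<Sum>k\<in>UNIV. \<Sum>l\<in>UNIV. spin (y $ k) * v $ flip l (flip k y)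
        - (if l = k then 2 * spin (y $ k) * v $ y else 0))"
      by (intro sum.cong) (auto simp: spin_flip left_diff_distrib)
    also have "\<dots> = (\<Sum>k\<in>UNIV. spin (y $ k) * (\<Sum>l\<in>UNIV. v $ flip l (flip k y)))
        - 2 * (\<Sum>k\<in>UNIV. spin (y $ k)) * v $ y"
      by (simp add: sum_subtractf sum_distrib_left sum_distrib_right)
    finally show ?thesis
      unfolding Aeps_mat_apply Astar_mat_apply A_mat_apply right_diff_distrib
      by (simp only: mult.assoc mult.left_commute [of \<i> 2])
  qed
  then show ?thesis by (simp add: vec_eq_iff)
qed

section \<open>The change of basis \<open>P_mat\<close>\<close>

lemma sum_vertex_prod:
  "(\<Sum>z\<in>UNIV. \<Prod>k\<in>UNIV. f k ((z :: 'n vertex) $ k)) = (\<Prod>k\<in>UNIV. \<Sum>b\<in>UNIV. f k b)"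
  for f :: "'n::finite \<Rightarrow> bool \<Rightarrow> complex"
proof -
  have "(\<Sum>z\<in>UNIV. \<Prod>k\<in>UNIV. f k ((z :: 'n vertex) $ k)) = (\<Sum>g\<in>UNIV. \<Prod>k\<in>UNIV. f k (g k))"
    by (rule sum.reindex_bij_witness [of _ vec_lambda vec_nth]) auto
  also have "\<dots> = (\<Prod>k\<in>UNIV. \<Sum>b\<in>UNIV. f k b)"
    using prod_sum_PiE [of "UNIV :: 'n set" "\<lambda>_. UNIV" f] by (simp add: PiE_UNIV_domain)
  finally show ?thesis .
qed

lemma P_mat_invertible: "P_mat ** matrix_inv P_mat = mat 1" "matrix_inv P_mat ** P_mat = mat 1"
proof -
  \<comment> \<open>The rows of \<open>P1_entry\<close> are orthogonal of squared norm 2, so half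
    the conjugate transpose inverts each Kronecker factor.\<close>
  define Q :: "'n::finite cmat" where "Q = (\<chi> z y. \<Prod>k\<in>UNIV. cnj (P1_entry (y $ k) (z $ k)) / 2)"
  have "(P_mat ** Q) $ y $ w = mat 1 $ y $ w" for y w
  proof -
    have "(P_mat ** Q) $ y $ w
        = (\<Sum>z\<in>UNIV. \<Prod>k\<in>UNIV. P1_entry (y $ k) (z $ k) * (cnj (P1_entry (w $ k) (z $ k)) / 2))"
      by (simp only: matrix_matrix_mult_def P_mat_def Q_def vec_lambda_beta prod.distrib)
    also have "\<dots> = (\<Prod>k\<in>UNIV. \<Sum>b\<in>UNIV. P1_entry (y $ k) b * (cnj (P1_entry (w $ k) b) / 2))"
      by (rule sum_vertex_prod)
    also have "\<dots> = (\<Prod>k\<in>UNIV. if y $ k = w $ k then 1 else 0)"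
      by (intro prod.cong) (auto simp: UNIV_bool P1_entry_def)
    also have "\<dots> = mat 1 $ y $ w"
      by (auto simp: mat_def vec_eq_iff)
    finally show ?thesis .
  qed
  then have PQ: "P_mat ** Q = mat 1" by (simp add: vec_eq_iff)
  then have "\<exists>A'. P_mat ** A' = mat 1 \<and> A' ** P_mat = (mat 1 :: 'n cmat)"
    using matrix_left_right_inverse by blast
  from someI_ex [OF this]
  show "P_mat ** matrix_inv P_mat = (mat 1 :: 'n cmat)" "matrix_inv P_mat ** P_mat = (mat 1 :: 'n cmat)"
    unfolding matrix_inv_def by auto
qed

lemma P_mat_cancel: "P_mat *v (matrix_inv P_mat *v v) = v" "matrix_inv P_mat *v (P_mat *v v) = v"
  by (simp_all add: matrix_vector_mul_assoc P_mat_invertible)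

text \<open>Only the factor at \<open>k\<close> changes, and
  \<open>P1_entry a (\<not> b) = spin a * P1_entry a b\<close>.\<close>

lemma P_mat_flip_right: "P_mat $ y $ flip k z = spin (y $ k) * P_mat $ y $ z"
proof -
  have "P_mat $ y $ flip k z
      = (\<Prod>l\<in>UNIV. (if l = k then spin (y $ k) else 1) * P1_entry (y $ l) (z $ l))"
    unfolding P_mat_def by (simp, intro prod.cong) (auto simp: flip_nth P1_entry_def spin_def)
  then show ?thesis by (simp add: prod.distrib P_mat_def)
qed

text \<open>Here the factor at \<open>k\<close> obeys \<open>P1_entry (\<not> a) b = - \<i> * spin b
  * spin a * P1_entry a b\<close>.\<close>

lemma P_mat_flip_left: "P_mat $ flip k y $ z = - \<i> * spin (z $ k) * (spin (y $ k) * P_mat $ y $ z)"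
proof -
  have "P_mat $ flip k y $ z
      = (\<Prod>l\<in>UNIV. (if l = k then - \<i> * spin (z $ k) * spin (y $ k) else 1) * P1_entry (y $ l) (z $ l))"
    unfolding P_mat_def by (simp, intro prod.cong) (auto simp: flip_nth P1_entry_def spin_def)
  then show ?thesis by (simp add: prod.distrib P_mat_def)
qed

lemma sum_flip: "(\<Sum>z\<in>UNIV. f (flip k z)) = (\<Sum>z\<in>UNIV. f z)"
  by (rule sum.reindex_bij_witness [of _ "flip k" "flip k"]) auto

lemma P_mat_A: "P_mat *v (A_mat *v v) = Astar_mat *v (P_mat *v v)"
proof -
  have "(P_mat *v (A_mat *v v)) $ y = (Astar_mat *v (P_mat *v v)) $ y" for y
  proof -
    have "(P_mat *v (A_mat *v v)) $ y = (\<Sum>z\<in>UNIV. P_mat $ y $ z * (\<Sum>k\<in>UNIV. v $ flip k z))"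
      by (simp add: matrix_vector_mult_def [of P_mat] A_mat_apply)
    \<comment> \<open>The double flip exhibits each summand as a function of
      \<open>flip k z\<close>; reindexing by the flip then moves it from \<open>v\<close> to the
      column index of \<open>P_mat\<close>.\<close>
    also have "\<dots> = (\<Sum>k\<in>UNIV. \<Sum>z\<in>UNIV. P_mat $ y $ flip k (flip k z) * v $ flip k z)"
      by (simp only: sum_distrib_left flip_flip) (rule sum.swap)
    also have "\<dots> = (\<Sum>k\<in>UNIV. \<Sum>z\<in>UNIV. P_mat $ y $ flip k z * v $ z)"
      by (intro sum.cong refl sum_flip)
    also have "\<dots> = (Astar_mat *v (P_mat *v v)) $ y"
      by (simp add: Astar_mat_apply matrix_vector_mult_def [of P_mat] P_mat_flip_right
          sum_product mult.assoc)
    finally show ?thesis .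
  qed
  then show ?thesis by (simp add: vec_eq_iff)
qed

lemma P_mat_Aeps: "P_mat *v (Aeps_mat *v v) = A_mat *v (P_mat *v v)"
proof -
  have "(P_mat *v (Aeps_mat *v v)) $ y = (A_mat *v (P_mat *v v)) $ y" for y
  proof -
    have "(P_mat *v (Aeps_mat *v v)) $ y
        = (\<Sum>z\<in>UNIV. \<Sum>k\<in>UNIV. P_mat $ y $ z * (\<i> * (spin (z $ k) * v $ flip k z)))"
      by (simp add: matrix_vector_mult_def [of P_mat] Aeps_mat_apply sum_distrib_left)
    also have "\<dots> = (\<Sum>k\<in>UNIV. \<Sum>z\<in>UNIV.
        P_mat $ y $ flip k (flip k z) * (\<i> * (spin (flip k (flip k z) $ k) * v $ flip k z)))"
      unfolding flip_flip by (rule sum.swap)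
    also have "\<dots> = (\<Sum>k\<in>UNIV. \<Sum>z\<in>UNIV. P_mat $ y $ flip k z * (\<i> * (spin (flip k z $ k) * v $ z)))"
      by (intro sum.cong refl sum_flip)
    \<comment> \<open>A column flip weighted by \<open>\<i>\<close> and the spin of the flipped
      coordinate amounts to a row flip.\<close>
    also have "\<dots> = (\<Sum>k\<in>UNIV. \<Sum>z\<in>UNIV. P_mat $ flip k y $ z * v $ z)"
      unfolding P_mat_flip_left P_mat_flip_right
      by (intro sum.cong refl) (simp add: flip_nth mult_ac)
    also have "\<dots> = (A_mat *v (P_mat *v v)) $ y"
      by (simp add: A_mat_apply matrix_vector_mult_def [of P_mat])
    finally show ?thesis .
  qed
  then show ?thesis by (simp add: vec_eq_iff)
qed

section \<open>The primitive idempotents as spectral families\<close>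

lemma spectral_family_conj:
  fixes X Y P R :: "complex ^ 'm ^ 'm"
  assumes E: "spectral_family D X E"
    and PR: "\<And>v. P *v (R *v v) = v" and RP: "\<And>v. R *v (P *v v) = v"
    and XY: "\<And>v. P *v (Y *v v) = X *v (P *v v)"
  shows "spectral_family D Y (\<lambda>i. R ** E i ** P)"
proof -
  have G: "(R ** E i ** P) *v v = R *v (E i *v (P *v v))" for i v
    by (simp add: matrix_vector_mul_assoc matrix_mul_assoc)
  have YR: "Y *v (R *v v) = R *v (X *v v)" for v
    by (metis PR RP XY)
  show ?thesis
    using E by (auto simp: spectral_family_def G YR vector_scalar_commute RP simp flip: mv_sum)
qed

lemma spectral_family_cong:
  assumes "spectral_family D X E" "\<And>i v. i \<le> D \<Longrightarrow> G i *v v = E i *v v"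
  shows "spectral_family D X G"
  using assms by (simp add: spectral_family_def)

lemma Estar_mat_apply: "(Estar_mat i *v v) $ y = (if weight y = i then v $ y else 0)"
proof -
  have "(Estar_mat i *v v) $ y = (\<Sum>z\<in>UNIV. if y = z then (if weight y = i then v $ y else 0) else 0)"
    unfolding matrix_vector_mult_def Estar_mat_def vec_lambda_beta cube_dist_base
    by (intro sum.cong) auto
  then show ?thesis by simp
qed

lemma spectral_family_Estar: "spectral_family CARD('n) Astar_mat (Estar_mat :: nat \<Rightarrow> 'n::finite cmat)"
  by (auto simp: spectral_family_def vec_eq_iff Estar_mat_apply Astar_mat_apply sum_spin weight_le)

lemma foldr_eigenvector:
  assumes "M *v x = \<mu> *s x"
  shows "foldr (**) (map (\<lambda>j. a j *\<^sub>M (M - t j *\<^sub>M mat 1)) js) (mat 1) *v x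
    = (\<Prod>j\<leftarrow>js. a j * (\<mu> - t j)) *s x"
proof (induction js)
  case (Cons j js)
  have "(a j *\<^sub>M (M - t j *\<^sub>M mat 1)) *v (b *s x) = (b * (a j * (\<mu> - t j))) *s x" for b
  proof -
    have "(a j *\<^sub>M (M - t j *\<^sub>M mat 1)) *v x = a j *s (\<mu> *s x - t j *s x)"
      by (simp only: cscale_mv matrix_vector_mult_diff_rdistrib assms matrix_vector_mul_lid)
    then show ?thesis
      by (simp only: vector_scalar_commute vec.scale_scale flip: vec.scale_left_diff_distrib)
  qed
  then show ?case using Cons by (simp add: mult.commute flip: matrix_vector_mul_assoc)
qed simp

text \<open>\<open>E_mat i\<close> is a Lagrange polynomial in \<open>A_mat\<close>, with value 1 at
  the node \<open>theta CARD('n) i\<close> and 0 at the other nodes.\<close>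

lemma E_mat_eigenvector:
  fixes x :: "'n::finite cvec"
  assumes x: "A_mat *v x = theta CARD('n) j *s x" and "i \<le> CARD('n)" "j \<le> CARD('n)"
  shows "E_mat i *v x = (if i = j then x else 0)"
proof -
  let ?D = "CARD('n)"
  let ?f = "\<lambda>l. 1 / (theta ?D i - theta ?D l) * (theta ?D j - theta ?D l)"
  let ?js = "filter (\<lambda>l. l \<noteq> i) [0..<Suc ?D]"
  have "(\<Prod>l\<leftarrow>?js. ?f l) = (if i = j then 1 else 0)"
  proof (cases "i = j")
    case True
    have "map ?f ?js = map (\<lambda>_. 1) ?js" 
      using True by (intro map_cong) (auto simp del: upt_Suc)
    then show ?thesis using True by (simp only: if_True) (simp add: map_replicate_const)
  next
    case False
    then have "j \<in> set ?js" using assms by auto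
    then show ?thesis using False by (auto simp: prod_list_zero_iff image_iff)
  qed
  then show ?thesis
    unfolding E_mat_def foldr_eigenvector [OF x] by simp
qed

text \<open>The Lagrange form gives the values of \<open>E_mat i\<close> on eigenvectors only. That
  these span comes from \<open>G\<close>, the conjugates of \<open>Estar_mat\<close> under
  \<open>P_mat\<close>.\<close>

lemma spectral_family_E: "spectral_family CARD('n) A_mat (E_mat :: nat \<Rightarrow> 'n::finite cmat)"
proof -
  define G where "G i = matrix_inv P_mat ** Estar_mat i ** (P_mat :: 'n cmat)" for i
  have G: "spectral_family CARD('n) A_mat G"
    unfolding G_def by (rule spectral_family_conj [OF spectral_family_Estar P_mat_cancel P_mat_A])
  have "E_mat i *v v = G i *v v" if i: "i \<le> CARD('n)" for i v
  proof -
    have "E_mat i *v v = (\<Sum>j\<le>CARD('n). E_mat i *v (G j *v v))"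
      using G by (simp add: spectral_family_def flip: mv_sum)
    also have "\<dots> = (\<Sum>j\<le>CARD('n). if i = j then G j *v v else 0)"
      using G i by (intro sum.cong refl E_mat_eigenvector) (auto simp: spectral_family_def)
    finally show ?thesis using i by simp
  qed
  then show ?thesis by (rule spectral_family_cong [OF G])
qed

lemma spectral_family_Eeps: "spectral_family CARD('n) Aeps_mat (Eeps_mat :: nat \<Rightarrow> 'n::finite cmat)"
  unfolding Eeps_mat_def
  by (rule spectral_family_conj [OF spectral_family_E P_mat_cancel P_mat_Aeps])

lemma su2_triple_cube: "su2_triple \<i> A_mat Astar_mat Aeps_mat"
  by (unfold_locales, simp) (rule A_Astar Astar_Aeps Aeps_A)+

section \<open>T-modules and the six representations\<close>

lemma T_module_iff:
  "T_module W \<longleftrightarrow> vec.subspace W \<and> invariant A_mat W \<and> invariant Astar_mat W"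
proof
  assume "T_module W"
  moreover have "A_mat \<in> T_alg" "Astar_mat \<in> T_alg"
    unfolding T_alg_def by (auto intro: hull_inc)
  ultimately show "vec.subspace W \<and> invariant A_mat W \<and> invariant Astar_mat W"
    by (auto simp: T_module_def invariant_def)
next
  assume W: "vec.subspace W \<and> invariant A_mat W \<and> invariant Astar_mat W"
  \<comment> \<open>The matrices preserving \<open>W\<close> form a subalgebra, which contains the
    hull of the generators.\<close>
  have "is_subalgebra {B. invariant B W}"
    using W unfolding is_subalgebra_def invariant_def
    by (auto simp: matrix_vector_mult_add_rdistrib cscale_mv vec.subspace_0 vec.subspace_add
        vec.subspace_scale simp flip: matrix_vector_mul_assoc)
  then have "T_alg \<subseteq> {B. invariant B W}"
    unfolding T_alg_def using W by (intro hull_minimal) auto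
  then show "T_module W" using W by (auto simp: T_module_def invariant_def)
qed

lemma invariant_Aeps_mat:
  assumes "vec.subspace W" "invariant A_mat W" "invariant Astar_mat W"
  shows "invariant Aeps_mat W"
  using assms unfolding invariant_def Aeps_mat_def
  by (auto simp: cscale_mv matrix_vector_mult_diff_rdistrib simp flip: matrix_vector_mul_assoc
      intro!: vec.subspace_scale vec.subspace_diff)

text \<open>\<open>Aeps_mat\<close> is a combination of products of the two generators, so it has no
  effect on which subspaces are invariant.\<close>

lemma irreducible_T_module_iff:
  "irreducible_T_module W \<longleftrightarrow> irreducible_under {A_mat, Astar_mat, Aeps_mat} W"
  unfolding irreducible_T_module_def irreducible_under_def T_module_iff
  using invariant_Aeps_mat by auto

theorem theorem10p2:
  fixes W :: "(complex ^ (bool ^ 'n::finite)) set"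
    and u ustar ueps :: "complex ^ (bool ^ 'n)"
    and r d :: nat
  assumes "irreducible_T_module W"
    and "r = module_endpoint W"
    and "d = module_diameter W"
    and "u \<in> mat_image (E_mat r) W" and "u \<noteq> 0"
    and "ustar \<in> mat_image (Estar_mat r) W" and "ustar \<noteq> 0"
    and "ueps \<in> mat_image (Eeps_mat r) W" and "ueps \<noteq> 0"
  shows "(represents W d (B_tridiag d) A_mat (\<lambda>i. Estar_mat (r + i) *v u) \<and>
          represents W d (B_tridiag d) A_mat (\<lambda>i. Eeps_mat (r + i) *v u)) \<and>
         (represents W d (B_tridiag d) Astar_mat (\<lambda>i. Eeps_mat (r + i) *v ustar) \<and>
          represents W d (B_tridiag d) Astar_mat (\<lambda>i. E_mat (r + i) *v ustar)) \<and>
         (represents W d (B_tridiag d) Aeps_mat (\<lambda>i. E_mat (r + i) *v ueps) \<and>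
          represents W d (B_tridiag d) Aeps_mat (\<lambda>i. Estar_mat (r + i) *v ueps))"
proof -
  let ?D = "CARD('n)"
  note E = spectral_family_E [where ?'n = 'n] and Es = spectral_family_Estar [where ?'n = 'n]
    and Ee = spectral_family_Eeps [where ?'n = 'n]
  note A = su2_triple_cube [where ?'a = 'n]
  note As = su2_triple.rotate [OF A] and Ae = su2_triple.rotate [OF su2_triple.rotate [OF A]]
  have irr: "irreducible_under {A_mat, Astar_mat, Aeps_mat} W"
    using assms(1) by (simp add: irreducible_T_module_iff)
  then have sub: "vec.subspace W" and inv: "invariant A_mat W" "invariant Astar_mat W" "invariant Aeps_mat W"
    by (auto simp: irreducible_under_def)
  have irr_perm: "irreducible_under {A_mat, Aeps_mat, Astar_mat} W"
    "irreducible_under {Astar_mat, Aeps_mat, A_mat} W" "irreducible_under {Astar_mat, A_mat, Aeps_mat} W"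
    "irreducible_under {Aeps_mat, A_mat, Astar_mat} W" "irreducible_under {Aeps_mat, Astar_mat, A_mat} W"
    using irr by (simp_all add: insert_commute)
  have ms: "module_support W = weight_support ?D Astar_mat W"
    using weight_support_iff_image [OF Es sub inv(2)]
    by (auto simp: module_support_def weight_support_def)
  have r: "r = Min (weight_support ?D Astar_mat W)"
    by (simp add: assms(2) module_endpoint_def ms)
  note sA = su2_triple.irreducible_support_dim [OF A E irr]
    and sAs = su2_triple.irreducible_support_dim [OF As Es irr_perm(2), folded r]
    and sAe = su2_triple.irreducible_support_dim [OF Ae Ee irr_perm(4)]
  \<comment> \<open>Each of the three minima \<open>m\<close> satisfies
    \<open>2 * m \<le> ?D\<close> and \<open>vec.dim W = Suc (?D - 2 * m)\<close>, so all equal the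
    endpoint, which is defined through \<open>Astar_mat\<close>.\<close>
  have "Min (weight_support ?D A_mat W) = r" "Min (weight_support ?D Aeps_mat W) = r"
    using sA(1,3) sAs(1,3) sAe(1,3) by linarith+
  then have supp: "weight_support ?D A_mat W = {r..?D - r}" "weight_support ?D Astar_mat W = {r..?D - r}"
    "weight_support ?D Aeps_mat W = {r..?D - r}"
    using sA(2) sAs(2) sAe(2) by simp_all
  \<comment> \<open>The support \<open>{r..?D - r}\<close> has \<open>?D - 2 * r + 1\<close>
    elements, and the diameter is one less.\<close>
  have d: "d = ?D - 2 * r"
    using sAs(1) by (simp add: assms(3) module_diameter_def ms supp)
  have in_image: "w \<in> W \<and> X *v w = theta ?D r *s w"
    if "spectral_family ?D X G" "invariant X W" "w \<in> mat_image (G r) W" for X G w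
    using that sAs(1) spectral_family_invariant [OF that(1) sub that(2), of _ r]
    by (auto simp: mat_image_def spectral_family_def)
  note u = in_image [OF E inv(1) assms(4)] and us = in_image [OF Es inv(2) assms(6)]
    and ue = in_image [OF Ee inv(3) assms(8)]
  note rep = su2_triple_represents [OF _ _ _ _ sAs(1,3), folded d]
  show ?thesis
    using u us ue assms(5,7,9) supp
    by (intro conjI rep [OF A irr E Es] rep [OF su2_triple.swap [OF A] irr_perm(1) E Ee]
        rep [OF As irr_perm(2) Es Ee] rep [OF su2_triple.swap [OF As] irr_perm(3) Es E]
        rep [OF Ae irr_perm(4) Ee E] rep [OF su2_triple.swap [OF Ae] irr_perm(5) Ee Es]) auto
qed

end
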